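(* Let $A_F\in\mathbb{R}^{n\times n}$ be symmetric, $f_F(y)=A_F\,y$, $f_S:\mathbb{R}^n\to\mathbb{R}^n$ continuously differentiable, $f=f_F+f_S$, $\eta\ge0$, and let $f_\eta$ be the averaged force associated with $(f_F,f_S,\eta)$. Suppose that there is $\mu\le 0$ with $$\Big\langle \frac{\partial f}{\partial y}(w)(z-y),z-y\Big\rangle\le \mu\|z-y\|^2\qquad\text{for all } w,y,z\in\mathbb{R}^n,$$ and that $A_F\frac{\partial f_S}{\partial y}(w)=\frac{\partial f_S}{\partial y}(w)A_F$ for all $w\in\mathbb{R}^n$. Let $y_0\in\mathbb{R}^n$, let $y$ be the solution of $y'=f(y)$, $y(0)=y_0$, and let $y_\eta$ be the solution of the modified equation $y_\eta'=f_\eta(y_\eta)$, $y_\eta(0)=y_0$. Then for all $t\ge 0$, $$\|y(t)-y_\eta(t)\|\le \max_{\lambda\in\lambda(A_F)}|1-\varphi(\eta\lambda)|\int_0^t e^{\mu_\eta(t-s)}\|f(y(s))\|\,ds,$$ with $\mu_\eta=\mu\,\min_{\lambda\in\lambda(A_F)}\{\varphi(\eta\lambda)\}\le 0$, where $\lambda(A_F)$ is the spectrum of $A_F$.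
   Context: $\langle\cdot,\cdot\rangle$ and $\|\cdot\|$ are the standard Euclidean scalar product and norm on $\mathbb{R}^n$, and $\frac{\partial f}{\partial y}(w)$ denotes the Jacobian matrix of $f$ at $w$. Averaged force: for $\eta>0$, $f_\eta(y)=\frac1\eta\,(u(\eta)-y)$, where $u:[0,\eta]\to\mathbb{R}^n$ is the solution of the auxiliary equation $u'=f_F(u)+f_S(y)$, $u(0)=y$ (with $y$ in $f_S(y)$ held fixed). For $\eta=0$, $f_0=f$. The function $\varphi$ is $\varphi(z)=(e^z-1)/z$ for $z\ne0$ and $\varphi(0)=1$. *)

theory Defs
  imports "HOL-Analysis.Analysis"
begin

definition continuously_differentiable :: "(real ^ 'n \<Rightarrow> real ^ 'm) \<Rightarrow> bool" where
  "continuously_differentiable g \<longleftrightarrow>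
     (\<forall>w. g differentiable (at w)) \<and> continuous_on UNIV (\<lambda>w. jacobian g (at w))"

text \<open>Derivatives are taken within the time interval \<open>I\<close> (containing 0), hence
  one-sided at its end points.\<close>

definition solves_ivp ::
  "('a::real_normed_vector \<Rightarrow> 'a) \<Rightarrow> 'a \<Rightarrow> real set \<Rightarrow> (real \<Rightarrow> 'a) \<Rightarrow> bool" where
  "solves_ivp g x0 I x \<longleftrightarrow>
     x 0 = x0 \<and> (\<forall>t\<in>I. (x has_vector_derivative g (x t)) (at t within I))"

text \<open>For \<open>\<eta> > 0\<close> the description operator picks out the end value \<open>u \<eta>\<close> of the solution of
  \<open>u' = fF u + fS y\<close>, \<open>u 0 = y\<close> on \<open>[0, \<eta>]\<close>, with \<open>y\<close> frozen in \<open>fS y\<close>. It denotes what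
  is intended whenever that problem is uniquely solvable, in particular for linear \<open>fF\<close>.
  Negative \<open>\<eta>\<close> is not meant to be used.\<close>

definition averaged_force ::
  "('a::real_normed_vector \<Rightarrow> 'a) \<Rightarrow> ('a \<Rightarrow> 'a) \<Rightarrow> real \<Rightarrow> 'a \<Rightarrow> 'a" where
  "averaged_force fF fS \<eta> y =
     (if \<eta> = 0 then fF y + fS y
      else (1 / \<eta>) *\<^sub>R
        ((THE v. \<exists>u. solves_ivp (\<lambda>x. fF x + fS y) y {0..\<eta>} u \<and> v = u \<eta>) - y))"

text \<open>Real eigenvalues only; this is the whole spectrum for symmetric matrices.\<close>

definition spectrum :: "real ^ 'n ^ 'n \<Rightarrow> real set" where
  "spectrum A = {l. \<exists>v. v \<noteq> 0 \<and> A *v v = l *\<^sub>R v}"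

definition phi :: "real \<Rightarrow> real" where
  "phi z = (if z = 0 then 1 else (exp z - 1) / z)"

end

theory Submission
  imports Defs
begin

text \<open>The force \<open>f\<close> enters the averaged force only through the constant matrix \<open>M = \<phi>(\<eta> A\<^sub>F)\<close>, namely
  \<open>f\<^sub>\<eta> = M f\<close> by variation of constants. The error \<open>e = y - y\<^sub>\<eta>\<close> thus satisfies
  \<open>e' = (I - M) f(y) + M (f(y) - f(y\<^sub>\<eta>))\<close>. The first term contributes the norm of \<open>I - M\<close>. For the
  second, the Jacobian of \<open>f\<close> commutes with \<open>A\<^sub>F\<close>, hence with the square root of the positive definite
  \<open>M\<close>, so the one-sided Lipschitz constant \<open>\<mu>\<close> of \<open>f\<close> turns into \<open>\<mu>\<^sub>\<eta>\<close> for \<open>M f\<close>. A differential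
  inequality for the norm of \<open>e\<close> gives the claim.\<close>

section \<open>Spectral theorem for self-adjoint maps\<close>

text \<open>The eigenvector maximises the Rayleigh quotient over the invariant subspace.\<close>

lemma symmetric_eigenvector_in_subspace:
  fixes T :: "'a::euclidean_space \<Rightarrow> 'a"
  assumes lin: "linear T" and sym: "\<And>x y. T x \<bullet> y = x \<bullet> T y"
    and S: "subspace S" and inv: "T ` S \<subseteq> S" and ne: "S \<noteq> {0}"
  obtains v r where "v \<in> S" "norm v = 1" "T v = r *\<^sub>R v"
proof -
  let ?K = "S \<inter> sphere 0 1"
  obtain x where x: "x \<in> S" "x \<noteq> 0"
    using ne S subspace_0 by blast
  have "(1 / norm x) *\<^sub>R x \<in> ?K"
    using x S by (simp add: subspace_scale)
  then have "?K \<noteq> {}" by blast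
  moreover have "compact ?K"
    using S by (simp add: closed_Int_compact closed_subspace)
  moreover have "continuous_on ?K (\<lambda>x. T x \<bullet> x)"
    by (intro continuous_intros linear_continuous_on linear_conv_bounded_linear[THEN iffD1] lin)
  ultimately obtain v where v: "v \<in> ?K" and max: "\<And>x. x \<in> ?K \<Longrightarrow> T x \<bullet> x \<le> T v \<bullet> v"
    using continuous_attains_sup[of ?K "\<lambda>x. T x \<bullet> x"] by blast
  define m where "m = T v \<bullet> v"
  \<comment> \<open>\<open>Q\<close> is the quadratic form of \<open>m - T\<close>. Since
    \<open>m\<close> is the largest Rayleigh quotient on \<open>S\<close>, \<open>Q\<close> is
    nonnegative on \<open>S\<close> and vanishes at \<open>v\<close>, so \<open>v\<close> minimises
    it there.\<close>
  define Q where "Q x = m * (x \<bullet> x) - T x \<bullet> x" for x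
  have vv: "v \<bullet> v = 1" using v by (simp add: dot_square_norm)
  have Q_nonneg: "Q x \<ge> 0" if "x \<in> S" for x
  proof (cases "x = 0")
    case True
    then show ?thesis by (simp add: Q_def linear_0[OF lin])
  next
    case False
    have "(1 / norm x) *\<^sub>R x \<in> ?K"
      using that False S by (simp add: subspace_scale)
    from max[OF this] have "(T x \<bullet> x) / (norm x)\<^sup>2 \<le> m"
      by (simp add: linear_scale[OF lin] m_def power2_eq_square)
    then show ?thesis
      using False by (simp add: Q_def dot_square_norm field_simps)
  qed
  define w where "w = T v - m *\<^sub>R v"
  have wS: "w \<in> S"
    using v inv S by (auto simp: w_def intro!: subspace_diff subspace_scale)
  \<comment> \<open>First variation of \<open>Q\<close> at \<open>v\<close>. The constant term is
    \<open>Q v = 0\<close>, and taking the residual \<open>w\<close> as direction turns the linear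
    coefficient into a negative multiple of its squared norm.\<close>
  have expand: "Q (v + t *\<^sub>R w) = - 2 * t * (w \<bullet> w) + t\<^sup>2 * Q w" for t
  proof -
    have "T w \<bullet> v = w \<bullet> T v" by (rule sym)
    then have "Q (v + t *\<^sub>R w) = 2 * t * (m * (v \<bullet> w) - T v \<bullet> w) + t\<^sup>2 * Q w"
      by (simp add: Q_def linear_add[OF lin] linear_scale[OF lin] inner_add_left inner_add_right
          inner_commute vv m_def algebra_simps power2_eq_square)
    moreover have "m * (v \<bullet> w) - T v \<bullet> w = - (w \<bullet> w)"
      by (subst (3) w_def) (simp add: inner_diff_left)
    ultimately show ?thesis by simp
  qed
  have nonneg: "0 \<le> - 2 * t * (w \<bullet> w) + t\<^sup>2 * Q w" for t
    using Q_nonneg[of "v + t *\<^sub>R w"] expand[of t] v wS S by (simp add: subspace_add subspace_scale)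
  have "w = 0"
  proof (rule ccontr)
    assume "w \<noteq> 0"
    then have ww: "w \<bullet> w > 0" and "\<not> (w \<bullet> w) * (w \<bullet> w) \<le> 0" by (simp_all add: not_le)
    show False
    proof (cases "Q w = 0")
      case True
      then show False using nonneg[of 1] ww by simp
    next
      case False
      then have q: "Q w > 0" using Q_nonneg[OF wS] by simp
      \<comment> \<open>This \<open>t\<close> minimises the quadratic polynomial in
        \<open>nonneg\<close>; its value there is \<open>- (w \<bullet> w)\<^sup>2 / Q w\<close>,
        which is negative.\<close>
      show False using nonneg[of "(w \<bullet> w) / Q w"] q \<open>\<not> (w \<bullet> w) * (w \<bullet> w) \<le> 0\<close>
        by (simp add: power2_eq_square field_simps del: mult_le_0_iff)
    qed
  qed
  then have "T v = m *\<^sub>R v" by (simp add: w_def)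
  with v that show thesis by auto
qed

text \<open>Induction on the dimension: self-adjointness makes the orthogonal complement of an
  eigenvector within \<open>S\<close> invariant again. Stating the result for all invariant
  subspaces is what lets the induction hypothesis apply to that complement.\<close>

lemma symmetric_orthonormal_eigenbasis:
  fixes T :: "'a::euclidean_space \<Rightarrow> 'a"
  assumes lin: "linear T" and sym: "\<And>x y. T x \<bullet> y = x \<bullet> T y"
  shows "subspace S \<Longrightarrow> T ` S \<subseteq> S \<Longrightarrow>
    \<exists>B. finite B \<and> pairwise orthogonal B \<and> span B = S \<and> (\<forall>b\<in>B. norm b = 1 \<and> (\<exists>r. T b = r *\<^sub>R b))"
proof (induction "dim S" arbitrary: S rule: less_induct)
  case less
  show ?case
  proof (cases "S = {0}")
    case True
    then show ?thesis by (intro exI[of _ "{}"]) auto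
  next
    case False
    obtain v r where v: "v \<in> S" "norm v = 1" "T v = r *\<^sub>R v"
      using symmetric_eigenvector_in_subspace[OF lin sym less.prems False] by blast
    have vv: "v \<bullet> v = 1" using v by (simp add: dot_square_norm)
    define S' where "S' = S \<inter> {x. v \<bullet> x = 0}"
    have sub: "subspace S'"
      unfolding S'_def by (intro subspace_inter less.prems subspace_hyperplane)
    have "v \<bullet> T x = r * (v \<bullet> x)" for x
      using sym[of v x] v(3) by simp
    then have inv: "T ` S' \<subseteq> S'"
      using less.prems by (auto simp: S'_def)
    have "v \<notin> S'" using vv by (simp add: S'_def)
    then have "S' \<subset> S" using v(1) unfolding S'_def by blast
    then have "dim S' < dim S"
      using dim_psubset sub less.prems by (metis span_eq_iff)
    then obtain B where B: "finite B" "pairwise orthogonal B" "span B = S'"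
        "\<forall>b\<in>B. norm b = 1 \<and> (\<exists>r. T b = r *\<^sub>R b)"
      using less.hyps sub inv by blast
    have "b \<in> S'" if "b \<in> B" for b using B(3) that span_base by blast
    then have "pairwise orthogonal (insert v B)"
      using B(2) by (auto simp: pairwise_insert S'_def orthogonal_def inner_commute)
    moreover have "span (insert v B) = S"
    proof
      show "span (insert v B) \<subseteq> S"
        using v(1) \<open>\<And>b. b \<in> B \<Longrightarrow> b \<in> S'\<close> less.prems(1)
        by (intro span_minimal) (auto simp: S'_def)
      show "S \<subseteq> span (insert v B)"
      proof
        fix x assume x: "x \<in> S"
        have "x - (v \<bullet> x) *\<^sub>R v \<in> S'"
          using x v vv less.prems(1)
          by (auto simp: S'_def inner_diff_right intro!: subspace_diff subspace_scale)
        then show "x \<in> span (insert v B)"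
          using B(3) by (auto simp: span_insert)
      qed
    qed
    ultimately show ?thesis
      using B v by (intro exI[of _ "insert v B"]) auto
  qed
qed

section \<open>Functional calculus in an orthonormal eigenbasis\<close>

locale orthonormal_eigenbasis =
  fixes T :: "'a::euclidean_space \<Rightarrow> 'a" and B :: "'a set" and ev :: "'a \<Rightarrow> real"
  assumes linear_T: "linear T" and selfadjoint: "\<And>x y. T x \<bullet> y = x \<bullet> T y"
    and fin: "finite B" and orth: "pairwise orthogonal B"
    and norm_1: "\<And>b. b \<in> B \<Longrightarrow> norm b = 1" and span_B: "span B = UNIV"
    and eigen: "\<And>b. b \<in> B \<Longrightarrow> T b = ev b *\<^sub>R b"
begin

lemma expand: "(\<Sum>b\<in>B. (x \<bullet> b) *\<^sub>R b) = x"
  using orthonormal_basis_expand[OF orth norm_1 _ fin] span_B by simp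

lemma basis_eqI: "(\<And>b. b \<in> B \<Longrightarrow> x \<bullet> b = y \<bullet> b) \<Longrightarrow> x = y"
  using expand[of x] expand[of y] by (metis (no_types, lifting) sum.cong)

text \<open>Parseval's identity.\<close>

lemma inner_expand: "x \<bullet> y = (\<Sum>b\<in>B. (x \<bullet> b) * (y \<bullet> b))"
proof -
  have "x \<bullet> y = x \<bullet> (\<Sum>b\<in>B. (y \<bullet> b) *\<^sub>R b)" by (simp add: expand)
  then show ?thesis by (simp add: inner_sum_right mult.commute)
qed

text \<open>The operator \<open>h(T)\<close>. Its independence of the chosen basis follows from
  \<open>fcalc_eigenvector\<close>.\<close>

definition fcalc :: "(real \<Rightarrow> real) \<Rightarrow> 'a \<Rightarrow> 'a" where
  "fcalc h x = (\<Sum>b\<in>B. (h (ev b) * (x \<bullet> b)) *\<^sub>R b)"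

lemma inner_sum_basis: "c \<in> B \<Longrightarrow> (\<Sum>b\<in>B. k b *\<^sub>R b) \<bullet> c = k c"
proof -
  assume c: "c \<in> B"
  have "(\<Sum>b\<in>B. k b *\<^sub>R b) \<bullet> c = (\<Sum>b\<in>B. if b = c then k c else 0)"
    using orth c norm_1[OF c]
    by (auto simp: inner_sum_left pairwise_def orthogonal_def dot_square_norm intro!: sum.cong)
  then show ?thesis using c fin by simp
qed

lemma fcalc_inner_basis: "b \<in> B \<Longrightarrow> fcalc h x \<bullet> b = h (ev b) * (x \<bullet> b)"
  by (simp add: fcalc_def inner_sum_basis)

lemma linear_fcalc: "linear (fcalc h)"
  by (rule linearI)
    (simp_all add: fcalc_def inner_add_left distrib_left scaleR_add_left sum.distrib
      scaleR_right.sum mult.left_commute)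

lemma T_inner_basis: "b \<in> B \<Longrightarrow> T x \<bullet> b = ev b * (x \<bullet> b)"
  by (simp add: selfadjoint eigen)

text \<open>An arbitrary eigenvector has nonzero components only along basis vectors with the same
  eigenvalue, because \<open>T\<close> acts diagonally on the components.\<close>

lemma fcalc_eigenvector:
  assumes "T v = r *\<^sub>R v"
  shows "fcalc h v = h r *\<^sub>R v"
proof (rule basis_eqI)
  fix b assume b: "b \<in> B"
  have "ev b * (v \<bullet> b) = r * (v \<bullet> b)"
    using T_inner_basis[OF b, of v] unfolding assms by (simp only: inner_scaleR_left)
  then show "fcalc h v \<bullet> b = h r *\<^sub>R v \<bullet> b"
    using b by (cases "v \<bullet> b = 0") (simp_all add: fcalc_inner_basis)
qed

text \<open>A map commuting with \<open>T\<close> preserves each eigenspace, and \<open>h(T)\<close>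
  is a scalar on each of them. So the two operators commute on the basis, hence everywhere by
  linearity.\<close>

lemma fcalc_commute:
  assumes J: "linear J" and comm: "\<And>x. J (T x) = T (J x)"
  shows "J (fcalc h x) = fcalc h (J x)"
proof -
  have *: "fcalc h (J b) = h (ev b) *\<^sub>R J b" if "b \<in> B" for b
    by (rule fcalc_eigenvector) (simp add: that eigen linear_scale[OF J] flip: comm)
  have "fcalc h (J x) = fcalc h (J (\<Sum>b\<in>B. (x \<bullet> b) *\<^sub>R b))" by (simp add: expand)
  also have "\<dots> = (\<Sum>b\<in>B. (x \<bullet> b) *\<^sub>R fcalc h (J b))"
    by (simp add: linear_sum[OF J] linear_sum[OF linear_fcalc] linear_scale[OF J]
        linear_scale[OF linear_fcalc])
  also have "\<dots> = (\<Sum>b\<in>B. J ((h (ev b) * (x \<bullet> b)) *\<^sub>R b))"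
    by (intro sum.cong) (simp_all add: * linear_scale[OF J])
  also have "\<dots> = J (fcalc h x)"
    by (simp add: fcalc_def linear_sum[OF J])
  finally show ?thesis by simp
qed

lemma fcalc_inner: "fcalc h x \<bullet> y = (\<Sum>b\<in>B. h (ev b) * (x \<bullet> b) * (y \<bullet> b))"
  by (subst inner_expand) (simp add: fcalc_inner_basis)

lemma fcalc_selfadjoint: "fcalc h x \<bullet> y = x \<bullet> fcalc h y"
  by (simp add: fcalc_inner inner_commute[of x] mult_ac)

lemma fcalc_fcalc: "fcalc h (fcalc k x) = fcalc (\<lambda>r. h r * k r) x"
  by (rule basis_eqI) (simp add: fcalc_inner_basis)

lemma fcalc_inner_ge:
  assumes "\<And>b. b \<in> B \<Longrightarrow> m \<le> h (ev b)"
  shows "m * (x \<bullet> x) \<le> fcalc h x \<bullet> x"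
  unfolding fcalc_inner
  by (subst inner_expand)
    (auto simp: sum_distrib_left mult.assoc intro!: sum_mono mult_right_mono assms)

lemma norm_fcalc_le:
  assumes "\<And>b. b \<in> B \<Longrightarrow> \<bar>h (ev b)\<bar> \<le> C" "0 \<le> C"
  shows "norm (fcalc h x) \<le> C * norm x"
proof (rule power2_le_imp_le)
  have "(norm (fcalc h x))\<^sup>2 = (\<Sum>b\<in>B. (h (ev b))\<^sup>2 * (x \<bullet> b)\<^sup>2)"
    unfolding dot_square_norm[symmetric]
    by (subst inner_expand) (simp add: fcalc_inner_basis power2_eq_square mult_ac)
  also have "\<dots> \<le> (\<Sum>b\<in>B. C\<^sup>2 * (x \<bullet> b)\<^sup>2)"
    using assms by (intro sum_mono mult_right_mono) (auto simp: abs_le_square_iff[symmetric])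
  also have "\<dots> = (C * norm x)\<^sup>2"
    unfolding power_mult_distrib dot_square_norm[symmetric]
    by (subst (2) inner_expand) (simp add: sum_distrib_left power2_eq_square)
  finally show "(norm (fcalc h x))\<^sup>2 \<le> (C * norm x)\<^sup>2" .
qed (simp add: assms)

text \<open>With \<open>N\<close> the square root of \<open>h(T)\<close>, commutation turns \<open>\<langle>h(T) J x, x\<rangle>\<close> into \<open>\<langle>J (N x), N x\<rangle>\<close>.\<close>

lemma fcalc_dissipative:
  assumes J: "linear J" and comm: "\<And>x. J (T x) = T (J x)"
    and diss: "\<And>x. J x \<bullet> x \<le> \<mu> * (x \<bullet> x)" and "\<mu> \<le> 0"
    and ge: "\<And>b. b \<in> B \<Longrightarrow> m \<le> h (ev b)" and nonneg: "\<And>r. 0 \<le> h r"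
  shows "fcalc h (J x) \<bullet> x \<le> \<mu> * m * (x \<bullet> x)"
proof -
  let ?N = "fcalc (\<lambda>r. sqrt (h r))"
  have sq: "fcalc h z = ?N (?N z)" for z
    by (simp add: fcalc_fcalc nonneg)
  have "fcalc h (J x) \<bullet> x = J (?N x) \<bullet> ?N x"
    by (simp add: sq fcalc_selfadjoint fcalc_commute[OF J comm])
  also have "\<dots> \<le> \<mu> * (?N x \<bullet> ?N x)" by (rule diss)
  also have "?N x \<bullet> ?N x = fcalc h x \<bullet> x"
    by (simp add: sq fcalc_selfadjoint)
  \<comment> \<open>Because \<open>\<mu> \<le> 0\<close>, the lower bound \<open>m\<close> of
    \<open>h(T)\<close> gives an upper bound here.\<close>
  also have "\<mu> * (fcalc h x \<bullet> x) \<le> \<mu> * (m * (x \<bullet> x))"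
    using \<open>\<mu> \<le> 0\<close> fcalc_inner_ge[of m h x] ge by (intro mult_left_mono_neg) auto
  finally show ?thesis by (simp add: mult.assoc)
qed

end

section \<open>The function \<open>phi\<close> and the closed form of the averaged force\<close>

lemma phi_pos: "phi z > 0"
  by (cases z "0::real" rule: linorder_cases) (auto simp: phi_def divide_simps)

text \<open>The product \<open>t * phi (t * r)\<close> is the integral of \<open>exp (s * r)\<close>
  over \<open>s\<close> from 0 to \<open>t\<close>. In this form the eigenvalue \<open>r = 0\<close>
  is covered as well.\<close>

lemma has_real_derivative_mult_phi:
  "((\<lambda>t. t * phi (t * r)) has_real_derivative exp (t * r)) (at t within X)"
proof (cases "r = 0")
  case True
  then show ?thesis by (auto simp: phi_def intro!: derivative_eq_intros)
next
  case False
  then have "(\<lambda>t. t * phi (t * r)) = (\<lambda>t. (exp (t * r) - 1) / r)"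
    by (auto simp: phi_def fun_eq_iff)
  with False show ?thesis by (auto intro!: derivative_eq_intros)
qed

lemma mult_phi: "r * (t * phi (t * r)) = exp (t * r) - 1"
  by (simp add: phi_def)

context orthonormal_eigenbasis
begin

text \<open>Variation of constants: integrating \<open>exp(s T) (T y + c)\<close> over
  \<open>s\<close> from 0 to \<open>t\<close> gives \<open>t phi(t T) (T y + c)\<close>. No inverse
  of \<open>T\<close> appears, so singular \<open>T\<close> is included.\<close>

lemma solves_affine_ivp:
  "solves_ivp (\<lambda>x. T x + c) y I (\<lambda>t. y + t *\<^sub>R fcalc (\<lambda>r. phi (t * r)) (T y + c))"
proof -
  let ?w = "T y + c"
  \<comment> \<open>All dependence on \<open>t\<close> is moved into scalar factors, which are
    differentiated one eigendirection at a time.\<close>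
  have u: "y + t *\<^sub>R fcalc (\<lambda>r. phi (t * r)) ?w
      = y + (\<Sum>b\<in>B. (t * phi (t * ev b)) *\<^sub>R ((?w \<bullet> b) *\<^sub>R b))" for t
    by (simp add: fcalc_def scaleR_sum_right mult.assoc)
  have summand: "((\<lambda>t. (t * phi (t * r)) *\<^sub>R x) has_vector_derivative exp (t * r) *\<^sub>R x)
      (at t within I)" for t r and x :: 'a
    by (intro bounded_linear.has_vector_derivative[OF bounded_linear_scaleR_left]
        has_real_derivative_mult_phi[unfolded has_real_derivative_iff_has_vector_derivative])
  have "((\<lambda>t. y + t *\<^sub>R fcalc (\<lambda>r. phi (t * r)) ?w) has_vector_derivative
      (\<Sum>b\<in>B. exp (t * ev b) *\<^sub>R ((?w \<bullet> b) *\<^sub>R b))) (at t within I)" for t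
    unfolding u
    using has_vector_derivative_add[OF has_vector_derivative_const
        has_vector_derivative_sum[OF summand], of y ev "\<lambda>b. (?w \<bullet> b) *\<^sub>R b" B t]
    by (simp only: add_0_left)
  moreover have "(\<Sum>b\<in>B. exp (t * ev b) *\<^sub>R ((?w \<bullet> b) *\<^sub>R b))
      = T (y + t *\<^sub>R fcalc (\<lambda>r. phi (t * r)) ?w) + c" for t
  proof (rule basis_eqI)
    fix b assume b: "b \<in> B"
    have "(\<Sum>b\<in>B. exp (t * ev b) *\<^sub>R ((?w \<bullet> b) *\<^sub>R b)) \<bullet> b = exp (t * ev b) * (?w \<bullet> b)"
      using inner_sum_basis[OF b, of "\<lambda>b. exp (t * ev b) * (?w \<bullet> b)"] by simp
    also have "\<dots> = (ev b * (t * phi (t * ev b)) + 1) * (?w \<bullet> b)"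
      by (simp only: mult_phi) simp
    also have "\<dots> = (T (y + t *\<^sub>R fcalc (\<lambda>r. phi (t * r)) ?w) + c) \<bullet> b"
      using b by (simp add: inner_add_left T_inner_basis fcalc_inner_basis algebra_simps)
    finally show "(\<Sum>b\<in>B. exp (t * ev b) *\<^sub>R ((?w \<bullet> b) *\<^sub>R b)) \<bullet> b = \<dots>" .
  qed
  ultimately show ?thesis by (simp add: solves_ivp_def)
qed

text \<open>In each eigendirection the difference of two solutions solves a scalar homogeneous
  linear equation, so the integrating factor makes \<open>q\<close> constant. This uniqueness
  justifies the description operator in \<open>averaged_force\<close>.\<close>

lemma affine_ivp_unique:
  assumes u: "solves_ivp (\<lambda>x. T x + c) y {0..t} u" and v: "solves_ivp (\<lambda>x. T x + c) y {0..t} v"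
    and t: "0 \<le> t"
  shows "u t = v t"
proof (rule basis_eqI)
  fix b assume b: "b \<in> B"
  define q where "q s = exp (- ev b * s) * ((u s - v s) \<bullet> b)" for s
  have "(q has_vector_derivative 0) (at s within {0..t})" if "s \<in> {0..t}" for s
  proof -
    have "((\<lambda>s. (u s - v s) \<bullet> b) has_vector_derivative (T (u s) - T (v s)) \<bullet> b)
        (at s within {0..t})"
      using u v that unfolding solves_ivp_def
      by (auto intro!: bounded_linear.has_vector_derivative[OF bounded_linear_inner_left]
          derivative_eq_intros)
    then have "((\<lambda>s. (u s - v s) \<bullet> b) has_real_derivative ev b * ((u s - v s) \<bullet> b))
        (at s within {0..t})"
      using b by (simp add: has_real_derivative_iff_has_vector_derivative inner_diff_left
          T_inner_basis algebra_simps)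
    then have "(q has_real_derivative 0) (at s within {0..t})"
      unfolding q_def by (auto intro!: derivative_eq_intros)
    then show ?thesis by (simp add: has_real_derivative_iff_has_vector_derivative)
  qed
  then have "q t = q 0"
    using has_vector_derivative_zero_constant[of "{0..t}" q] t by (metis (no_types, lifting)
      atLeastAtMost_iff convex_real_interval(5) order_refl)
  then show "u t \<bullet> b = v t \<bullet> b"
    using u v by (simp add: q_def solves_ivp_def inner_diff_left)
qed

lemma averaged_force_eq:
  assumes "\<eta> \<ge> 0"
  shows "averaged_force T g \<eta> y = fcalc (\<lambda>r. phi (\<eta> * r)) (T y + g y)"
proof (cases "\<eta> = 0")
  case True
  \<comment> \<open>As \<open>phi 0 = 1\<close>, the functional calculus reduces to the identity at
    \<open>\<eta> = 0\<close>.\<close>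
  then show ?thesis by (simp add: averaged_force_def fcalc_def phi_def expand)
next
  case False
  let ?u = "\<lambda>t. y + t *\<^sub>R fcalc (\<lambda>r. phi (t * r)) (T y + g y)"
  have "(THE v. \<exists>u. solves_ivp (\<lambda>x. T x + g y) y {0..\<eta>} u \<and> v = u \<eta>) = ?u \<eta>"
  proof (rule the_equality)
    show "\<exists>u. solves_ivp (\<lambda>x. T x + g y) y {0..\<eta>} u \<and> ?u \<eta> = u \<eta>"
      using solves_affine_ivp by blast
    show "v = ?u \<eta>" if "\<exists>u. solves_ivp (\<lambda>x. T x + g y) y {0..\<eta>} u \<and> v = u \<eta>" for v
      using that affine_ivp_unique[OF _ solves_affine_ivp assms] by blast
  qed
  with False show ?thesis by (simp add: averaged_force_def)
qed

end

section \<open>One-sided Lipschitz condition and differential inequality\<close>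

text \<open>Mean value theorem for the scalar function obtained by restricting \<open>g\<close> to
  the segment from \<open>x\<close> to \<open>y\<close> and pairing it with
  \<open>y - x\<close>.\<close>

lemma one_sided_Lipschitz:
  fixes g :: "'a::real_inner \<Rightarrow> 'a"
  assumes der: "\<And>w. (g has_derivative g' w) (at w)"
    and le: "\<And>w x. g' w x \<bullet> x \<le> c * (x \<bullet> x)"
  shows "(g y - g x) \<bullet> (y - x) \<le> c * ((y - x) \<bullet> (y - x))"
proof -
  let ?p = "\<lambda>s::real. x + s *\<^sub>R (y - x)"
  have "((\<lambda>s. g (?p s) \<bullet> (y - x)) has_derivative (\<lambda>s. g' (?p r) (s *\<^sub>R (y - x)) \<bullet> (y - x)))
      (at r within {0..1})" for r
    by (intro has_derivative_inner_left has_derivative_compose[OF _ der])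
      (auto intro!: derivative_eq_intros)
  then obtain r where "g (?p 1) \<bullet> (y - x) - g (?p 0) \<bullet> (y - x)
      = g' (?p r) ((1 - 0) *\<^sub>R (y - x)) \<bullet> (y - x)"
    using mvt_simple[of 0 "1::real" "\<lambda>s. g (?p s) \<bullet> (y - x)"
        "\<lambda>r s. g' (?p r) (s *\<^sub>R (y - x)) \<bullet> (y - x)"] by auto
  then show ?thesis using le[of "?p r" "y - x"] by (simp add: inner_diff_left)
qed

lemma norm_Gronwall:
  fixes e e' :: "real \<Rightarrow> 'a::real_inner"
  assumes der: "\<And>s. s \<in> {0..t} \<Longrightarrow> (e has_vector_derivative e' s) (at s within {0..t})"
    and le: "\<And>s. s \<in> {0..t} \<Longrightarrow> e' s \<bullet> e s \<le> \<mu> * (norm (e s))\<^sup>2 + g s * norm (e s)"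
    and cont: "continuous_on {0..t} g" and nonneg: "\<And>s. s \<in> {0..t} \<Longrightarrow> 0 \<le> g s"
    and "\<mu> \<le> 0" "0 \<le> t"
  shows "norm (e t) \<le> exp (\<mu> * t) * norm (e 0) + integral {0..t} (\<lambda>s. exp (\<mu> * (t - s)) * g s)"
  \<comment> \<open>\<open>norm (e s)\<close> need not be differentiable at zeros of \<open>e\<close>, so it is smoothed to \<open>\<psi>\<close>.\<close>
proof (rule field_le_epsilon)
  fix \<epsilon> :: real assume \<epsilon>: "\<epsilon> > 0"
  define \<psi> where "\<psi> s = sqrt ((norm (e s))\<^sup>2 + \<epsilon>\<^sup>2)" for s
  have \<psi>_ge: "\<psi> s \<ge> \<epsilon>" "\<psi> s \<ge> norm (e s)" for s
    unfolding \<psi>_def by (auto intro!: real_le_rsqrt)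
  have \<psi>_sq: "\<psi> s * \<psi> s = (norm (e s))\<^sup>2 + \<epsilon>\<^sup>2" for s
    unfolding \<psi>_def by simp
  have \<psi>_pos: "\<psi> s > 0" for s using \<psi>_ge(1)[of s] \<epsilon> by linarith
  have d\<psi>: "(\<psi> has_real_derivative (e' s \<bullet> e s) / \<psi> s) (at s within {0..t})" if "s \<in> {0..t}" for s
  proof -
    have "((\<lambda>s. e s \<bullet> e s + \<epsilon>\<^sup>2) has_real_derivative 2 * (e' s \<bullet> e s)) (at s within {0..t})"
      unfolding has_real_derivative_iff_has_vector_derivative
      using has_vector_derivative_add[OF bounded_bilinear.has_vector_derivative
          [OF bounded_bilinear_inner der[OF that] der[OF that]] has_vector_derivative_const]
      by (simp add: inner_commute)
    then have "((\<lambda>s. sqrt (e s \<bullet> e s + \<epsilon>\<^sup>2)) has_real_derivative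
        (inverse (sqrt (e s \<bullet> e s + \<epsilon>\<^sup>2)) / 2) * (2 * (e' s \<bullet> e s))) (at s within {0..t})"
      using \<epsilon> by (intro DERIV_chain2[OF DERIV_real_sqrt]) (auto simp: add_nonneg_pos)
    then show ?thesis
      by (simp add: \<psi>_def[abs_def] dot_square_norm field_simps)
  qed
  have slope: "(e' s \<bullet> e s) / \<psi> s \<le> \<mu> * (\<psi> s - \<epsilon>) + g s" if "s \<in> {0..t}" for s
  proof -
    have "e' s \<bullet> e s \<le> \<mu> * (\<psi> s * \<psi> s - \<epsilon> * \<epsilon>) + g s * norm (e s)"
      using le[OF that] by (simp add: \<psi>_sq power2_eq_square)
    \<comment> \<open>From \<open>\<psi> s \<ge> \<epsilon>\<close> and
      \<open>\<mu> \<le> 0\<close>, \<open>\<epsilon> * \<epsilon>\<close> may be replaced by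
      \<open>\<epsilon> * \<psi> s\<close>. Division by \<open>\<psi> s\<close> then leaves for
      \<open>\<psi> - \<epsilon>\<close> the linear inequality expected of
      \<open>norm (e s)\<close>.\<close>
    also have "\<dots> \<le> \<mu> * (\<psi> s * \<psi> s - \<epsilon> * \<psi> s) + g s * \<psi> s"
      using \<psi>_ge[of s] \<epsilon> \<open>\<mu> \<le> 0\<close> nonneg[OF that]
      by (intro add_mono mult_left_mono_neg mult_left_mono diff_left_mono) auto
    finally show ?thesis using \<psi>_pos[of s] by (simp add: field_simps)
  qed
  define G where "G s = exp (- \<mu> * s) * g s" for s
  have contG: "continuous_on {0..t} G"
    unfolding G_def by (intro continuous_intros cont)
  \<comment> \<open>With the integrating factor, the linear inequality for
    \<open>\<psi> - \<epsilon>\<close> says exactly that \<open>H\<close> has nonpositive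
    derivative.\<close>
  define H where "H s = exp (- \<mu> * s) * (\<psi> s - \<epsilon>) - integral {0..s} G" for s
  define H' where "H' s = exp (- \<mu> * s) * ((e' s \<bullet> e s) / \<psi> s - \<mu> * (\<psi> s - \<epsilon>)) - G s" for s
  have dH: "(H has_real_derivative H' s) (at s within {0..t})" if "s \<in> {0..t}" for s
  proof -
    have "((\<lambda>s. integral {0..s} G) has_real_derivative G s) (at s within {0..t})"
      using integral_has_vector_derivative[OF contG that]
      by (simp add: has_real_derivative_iff_has_vector_derivative)
    then show ?thesis
      unfolding H_def H'_def
      by (auto intro!: derivative_eq_intros d\<psi>[OF that] simp: algebra_simps)
  qed
  have H'_le: "H' s \<le> 0" if "s \<in> {0..t}" for s
    using mult_left_mono[OF slope[OF that], of "exp (- \<mu> * s)"]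
    by (simp add: H'_def G_def algebra_simps)
  have "H t \<le> H 0"
  \<comment> \<open>Two-sided derivatives are available only in the interior of
    \<open>{0..t}\<close>; continuity handles the end points.\<close>
  proof (rule DERIV_nonpos_imp_decreasing_open[OF \<open>0 \<le> t\<close>])
    show "\<exists>y. (H has_real_derivative y) (at s) \<and> y \<le> 0" if "0 < s" "s < t" for s
      using dH[of s] H'_le[of s] that at_within_Icc_at[of 0 s t] by auto
    show "continuous_on {0..t} H"
      using dH by (rule DERIV_continuous_on)
  qed
  also have "H 0 \<le> norm (e 0)"
    using \<epsilon> sqrt_sum_squares_le_sum[of "norm (e 0)" \<epsilon>] by (simp add: H_def \<psi>_def)
  finally have "exp (- \<mu> * t) * (\<psi> t - \<epsilon>) \<le> norm (e 0) + integral {0..t} G"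
    by (simp add: H_def)
  then have "exp (\<mu> * t) * (exp (- \<mu> * t) * (\<psi> t - \<epsilon>))
      \<le> exp (\<mu> * t) * (norm (e 0) + integral {0..t} G)"
    by (rule mult_left_mono) simp
  moreover have "exp (\<mu> * t) * exp (- \<mu> * t) = 1"
    by (simp flip: exp_add)
  moreover have "exp (\<mu> * t) * integral {0..t} G = integral {0..t} (\<lambda>s. exp (\<mu> * (t - s)) * g s)"
    unfolding integral_mult_right[symmetric] G_def
    by (simp add: mult.assoc[symmetric] exp_add[symmetric] right_diff_distrib)
  ultimately have "\<psi> t - \<epsilon> \<le> exp (\<mu> * t) * norm (e 0) + integral {0..t} (\<lambda>s. exp (\<mu> * (t - s)) * g s)"
    by (simp add: mult.assoc[symmetric] distrib_left)
  then show "norm (e t) \<le> exp (\<mu> * t) * norm (e 0)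
      + integral {0..t} (\<lambda>s. exp (\<mu> * (t - s)) * g s) + \<epsilon>"
    using \<psi>_ge(2)[of t] by linarith
qed

section \<open>The error estimate\<close>

theorem theorem2p5:
  fixes AF :: "real ^ 'n ^ 'n"
    and fF fS f :: "real ^ 'n \<Rightarrow> real ^ 'n"
    and \<eta> \<mu> \<mu>\<^sub>\<eta> :: real
    and y0 :: "real ^ 'n"
    and y y\<^sub>\<eta> :: "real \<Rightarrow> real ^ 'n"
  assumes "transpose AF = AF"
    and "fF = (\<lambda>x. AF *v x)"
    and "continuously_differentiable fS"
    and "f = (\<lambda>x. fF x + fS x)"
    and "\<eta> \<ge> 0"
    and "\<mu> \<le> 0"
    and "\<forall>w x z. (jacobian f (at w) *v (z - x)) \<bullet> (z - x) \<le> \<mu> * (norm (z - x))\<^sup>2"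
    and "\<forall>w. AF ** jacobian fS (at w) = jacobian fS (at w) ** AF"
    and "solves_ivp f y0 {0..} y"
    and "solves_ivp (averaged_force fF fS \<eta>) y0 {0..} y\<^sub>\<eta>"
    and "\<mu>\<^sub>\<eta> = \<mu> * Min ((\<lambda>l. phi (\<eta> * l)) ` spectrum AF)"
  shows "\<mu>\<^sub>\<eta> \<le> 0 \<and>
    (\<forall>t\<ge>0. norm (y t - y\<^sub>\<eta> t)
       \<le> Max ((\<lambda>l. \<bar>1 - phi (\<eta> * l)\<bar>) ` spectrum AF)
          * integral {0..t} (\<lambda>s. exp (\<mu>\<^sub>\<eta> * (t - s)) * norm (f (y s))))"
proof -
  have fF: "linear fF" using assms(2) by simp
  have fF_sym: "fF x \<bullet> z = x \<bullet> fF z" for x z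
    using dot_lmul_matrix[of x AF z] assms(1,2)
    by (metis inner_commute transpose_matrix_vector)
  obtain B where B: "finite B" "pairwise orthogonal B" "span B = UNIV"
      "\<forall>b\<in>B. norm b = 1 \<and> (\<exists>r. fF b = r *\<^sub>R b)"
    using symmetric_orthonormal_eigenbasis[OF fF fF_sym, of UNIV] by auto
  then obtain ev where ev: "\<And>b. b \<in> B \<Longrightarrow> fF b = ev b *\<^sub>R b" by metis
  interpret orthonormal_eigenbasis fF B ev
    by (rule orthonormal_eigenbasis.intro) (use fF fF_sym B ev in auto)
  have spec: "spectrum AF = ev ` B"
  proof
    show "ev ` B \<subseteq> spectrum AF"
    proof
      fix r assume "r \<in> ev ` B"
      then obtain b where "b \<in> B" "r = ev b" by blast
      then show "r \<in> spectrum AF"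
        using ev[of b] norm_1[of b] assms(2) by (auto simp: spectrum_def intro!: exI[of _ b])
    qed
    show "spectrum AF \<subseteq> ev ` B"
    proof
      fix r assume "r \<in> spectrum AF"
      then obtain v where v: "v \<noteq> 0" "fF v = r *\<^sub>R v"
        using assms(2) by (auto simp: spectrum_def)
      then obtain b where b: "b \<in> B" "v \<bullet> b \<noteq> 0"
        using basis_eqI[of v 0] by auto
      then have "ev b = r" using T_inner_basis[of b v] v by simp
      with b show "r \<in> ev ` B" by blast
    qed
  qed
  have "B \<noteq> {}"
    using span_B by (metis UNIV_not_singleton span_empty)
  define m where "m = Min ((\<lambda>l. phi (\<eta> * l)) ` spectrum AF)"
  define C where "C = Max ((\<lambda>l. \<bar>1 - phi (\<eta> * l)\<bar>) ` spectrum AF)"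
  have m_le: "m \<le> phi (\<eta> * ev b)" and C_ge: "\<bar>1 - phi (\<eta> * ev b)\<bar> \<le> C" if "b \<in> B" for b
    using that fin by (auto simp: m_def C_def spec intro!: Min_le Max_ge)
  have "m > 0"
    using fin \<open>B \<noteq> {}\<close> phi_pos by (simp add: m_def spec)
  have "C \<ge> 0"
    using C_ge \<open>B \<noteq> {}\<close> abs_ge_zero by (metis equals0I order_trans)
  have \<mu>\<eta>: "\<mu>\<^sub>\<eta> = \<mu> * m" using assms(11) by (simp add: m_def)
  have "\<mu>\<^sub>\<eta> \<le> 0"
    unfolding \<mu>\<eta> using assms(6) \<open>m > 0\<close> by (simp add: mult_nonpos_nonneg)
  define M where "M = fcalc (\<lambda>r. phi (\<eta> * r))"
  have avg: "averaged_force fF fS \<eta> x = M (f x)" for x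
    using averaged_force_eq[OF assms(5)] assms(4) by (simp add: M_def)
  have dS: "(fS has_derivative (\<lambda>h. jacobian fS (at w) *v h)) (at w)" for w
    using assms(3) jacobian_works by (auto simp: continuously_differentiable_def)
  \<comment> \<open>The commutation hypothesis concerns the Jacobian of \<open>fS\<close>, the
    dissipativity hypothesis that of \<open>f\<close>. \<open>J\<close> is built for the former and
    identified with the latter by uniqueness of derivatives.\<close>
  define J where "J w h = fF h + jacobian fS (at w) *v h" for w h
  have df: "(f has_derivative J w) (at w)" for w
    unfolding assms(4) J_def
    by (intro has_derivative_add dS linear_imp_has_derivative fF)
  have J_lin: "linear (J w)" for w
    using df has_derivative_linear by blast
  have J_comm: "J w (fF x) = fF (J w x)" for w x
    using assms(8) unfolding J_def assms(2)
    by (simp add: matrix_vector_right_distrib matrix_vector_mul_assoc)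
  have "J w = (\<lambda>h. jacobian f (at w) *v h)" for w
    using df jacobian_works[of f "at w"] has_derivative_unique differentiable_def by metis
  then have J_diss: "J w x \<bullet> x \<le> \<mu> * (x \<bullet> x)" for w x
    using assms(7)[rule_format, of w x 0] by (simp add: dot_square_norm)
  have M_diss: "M (J w x) \<bullet> x \<le> \<mu>\<^sub>\<eta> * (x \<bullet> x)" for w x
    unfolding M_def \<mu>\<eta>
    by (rule fcalc_dissipative[OF J_lin J_comm J_diss assms(6)])
      (simp_all add: m_le less_imp_le phi_pos)
  have "bounded_linear M"
    unfolding M_def linear_conv_bounded_linear[symmetric] by (rule linear_fcalc)
  then have dM: "((\<lambda>x. M (f x)) has_derivative (\<lambda>h. M (J w h))) (at w)" for w
    using df by (rule bounded_linear.has_derivative)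
  have M_mono: "(M (f z) - M (f x)) \<bullet> (z - x) \<le> \<mu>\<^sub>\<eta> * ((z - x) \<bullet> (z - x))" for z x
    using dM M_diss by (rule one_sided_Lipschitz)
  have M_near_id: "norm (x - M x) \<le> C * norm x" for x
  proof -
    have "x - M x = fcalc (\<lambda>r. 1 - phi (\<eta> * r)) x"
      by (rule basis_eqI) (simp add: M_def inner_diff_left fcalc_inner_basis algebra_simps)
    then show ?thesis
      using norm_fcalc_le[of "\<lambda>r. 1 - phi (\<eta> * r)" C x] C_ge \<open>C \<ge> 0\<close> by simp
  qed
  have "norm (y t - y\<^sub>\<eta> t) \<le> C * integral {0..t} (\<lambda>s. exp (\<mu>\<^sub>\<eta> * (t - s)) * norm (f (y s)))"
    if "t \<ge> 0" for t
  proof -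
    have dy: "(y has_vector_derivative f (y s)) (at s within {0..t})"
      and dy\<eta>: "(y\<^sub>\<eta> has_vector_derivative M (f (y\<^sub>\<eta> s))) (at s within {0..t})"
      if "s \<in> {0..t}" for s
      using assms(9,10) that avg unfolding solves_ivp_def
      by (auto intro: has_vector_derivative_within_subset[of _ _ s "{0..}"])
    have "continuous_on {0..t} y"
      using dy by (rule continuous_on_vector_derivative)
    moreover have "continuous_on UNIV f"
      using df by (auto intro!: has_derivative_continuous_on)
    ultimately have "continuous_on {0..t} (\<lambda>s. f (y s))"
      using continuous_on_compose2 by blast
    then have cont: "continuous_on {0..t} (\<lambda>s. C * norm (f (y s)))"
      by (intro continuous_intros)
    \<comment> \<open>Splitting at \<open>M (f (y s))\<close>: Cauchy-Schwarz and
      \<open>M_near_id\<close> bound the defect, and \<open>M_mono\<close> bounds the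
      remainder.\<close>
    have "(f (y s) - M (f (y\<^sub>\<eta> s))) \<bullet> (y s - y\<^sub>\<eta> s)
        \<le> \<mu>\<^sub>\<eta> * (norm (y s - y\<^sub>\<eta> s))\<^sup>2 + C * norm (f (y s)) * norm (y s - y\<^sub>\<eta> s)" for s
    proof -
      have "(f (y s) - M (f (y s))) \<bullet> (y s - y\<^sub>\<eta> s)
          \<le> norm (f (y s) - M (f (y s))) * norm (y s - y\<^sub>\<eta> s)"
        by (rule norm_cauchy_schwarz)
      also have "\<dots> \<le> C * norm (f (y s)) * norm (y s - y\<^sub>\<eta> s)"
        by (intro mult_right_mono M_near_id) simp
      finally show ?thesis
        using M_mono[of "y s" "y\<^sub>\<eta> s"] by (simp add: dot_square_norm inner_diff_left)
    qed
    then have "norm (y t - y\<^sub>\<eta> t) \<le> exp (\<mu>\<^sub>\<eta> * t) * norm (y 0 - y\<^sub>\<eta> 0)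
        + integral {0..t} (\<lambda>s. exp (\<mu>\<^sub>\<eta> * (t - s)) * (C * norm (f (y s))))"
      using \<open>C \<ge> 0\<close> \<open>\<mu>\<^sub>\<eta> \<le> 0\<close> \<open>t \<ge> 0\<close> cont
      by (intro norm_Gronwall[where e' = "\<lambda>s. f (y s) - M (f (y\<^sub>\<eta> s))"])
        (auto intro!: has_vector_derivative_diff dy dy\<eta>)
    also have "y 0 - y\<^sub>\<eta> 0 = 0"
      using assms(9,10) by (simp add: solves_ivp_def)
    finally show ?thesis
      by (simp add: mult.left_commute[of _ C])
  qed
  with \<open>\<mu>\<^sub>\<eta> \<le> 0\<close> show ?thesis by (simp add: C_def)
qed

end
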